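(* The bivariate sextic polynomial $$p(x_1,x_2) = 17x_1^6 - 20x_1^4 + 7x_1^2 + 18x_1 + 18x_2^4 - 19x_2^2 - 19x_2 + 21 - 20x_1x_2$$ is separable plus quadratic (SPQ) and nonnegative, but it is not a sum of squares.
   Context: All polynomials have real coefficients. A polynomial $p:\mathbb{R}^n\to\mathbb{R}$ is separable plus quadratic (SPQ) if $p(x)=s(x)+q(x)$, where $s(x)=\sum_{i=1}^n s_i(x_i)$ for some univariate polynomials $s_i$ and $q(x)$ is a quadratic polynomial (degree at most $2$). A polynomial is nonnegative if $p(x)\ge 0$ for all $x\in\mathbb{R}^n$, and a sum of squares (sos) if $p=\sum_{i=1}^m q_i^2$ for some polynomials $q_1,\dots,q_m$ with real coefficients. *)

theory Defs
  imports "HOL-Analysis.Analysis" "HOL-Library.Poly_Mapping"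
begin

text \<open>
  Real polynomials in variables indexed by the finite type \<open>'n\<close>: finitely supported maps from
  monomials (exponent vectors) to coefficients. The ring operations, in particular the
  convolution product, are those of \<^theory>\<open>HOL-Library.Poly_Mapping\<close>. For bivariate polynomials the index type is \<open>2\<close>, whose
  two elements are \<open>1\<close> and \<open>2\<close> (its arithmetic is modulo 2, so \<open>2\<close> is also written \<open>0\<close>).
\<close>

type_synonym 'n rpoly = "('n \<Rightarrow>\<^sub>0 nat) \<Rightarrow>\<^sub>0 real"

definition const_poly :: "real \<Rightarrow> 'n rpoly" where
  "const_poly c = Poly_Mapping.single 0 c"

definition var_poly :: "'n \<Rightarrow> 'n rpoly" where
  "var_poly i = Poly_Mapping.single (Poly_Mapping.single i 1) 1"

definition peval :: "'n::finite rpoly \<Rightarrow> real ^ 'n \<Rightarrow> real" where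
  "peval p x = (\<Sum>m\<in>Poly_Mapping.keys p.
     Poly_Mapping.lookup p m * (\<Prod>i\<in>UNIV. (x $ i) ^ Poly_Mapping.lookup m i))"

text \<open>The zero polynomial gets total degree 0.\<close>

definition total_degree :: "'n::finite rpoly \<Rightarrow> nat" where
  "total_degree p =
     Max (insert 0 ((\<lambda>m. \<Sum>i\<in>UNIV. Poly_Mapping.lookup m i) ` Poly_Mapping.keys p))"

text \<open>Substitution of the variable with index \<open>i\<close> into a univariate polynomial.\<close>

definition in_var :: "real poly \<Rightarrow> 'n \<Rightarrow> 'n rpoly" where
  "in_var f i = poly (map_poly const_poly f) (var_poly i)"

definition SPQ :: "'n::finite rpoly \<Rightarrow> bool" where
  "SPQ p \<longleftrightarrow> (\<exists>(s :: 'n \<Rightarrow> real poly) (q :: 'n rpoly).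
     total_degree q \<le> 2 \<and> p = (\<Sum>i\<in>UNIV. in_var (s i) i) + q)"

definition nonneg_poly :: "'n::finite rpoly \<Rightarrow> bool" where
  "nonneg_poly p \<longleftrightarrow> (\<forall>x. peval p x \<ge> 0)"

definition sos :: "'n rpoly \<Rightarrow> bool" where
  "sos p \<longleftrightarrow> (\<exists>(m :: nat) (q :: nat \<Rightarrow> 'n rpoly). p = (\<Sum>j<m. (q j)\<^sup>2))"

end

theory Submission
  imports Defs
begin

text \<open>
  Completing squares in \<open>y\<close> bounds \<open>p\<close> from below by univariate polynomials, which are nonnegative.
  If \<open>p\<close> were the sum of the squares \<open>q\<^sub>j\<^sup>2\<close>, growth along monomial curves would confine
  every \<open>q\<^sub>j\<close> to the monomials \<open>x^a y^b\<close> with \<open>2 a + 3 b \<le> 6\<close>. On their span there is a relation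
  \<open>q(P\<^sub>0) = \<Sum>k. \<beta>\<^sub>k q(P\<^sub>k)\<close> between evaluations at six points, so the triangle inequality for
  the vector \<open>(q\<^sub>j(P))\<^sub>j\<close>, whose Euclidean norm is \<open>sqrt (p(P))\<close>, gives
  \<open>sqrt (p(P\<^sub>0)) \<le> \<Sum>k. \<bar>\<beta>\<^sub>k\<bar> sqrt (p(P\<^sub>k))\<close>, which is false for a suitable choice of the points.
\<close>

section \<open>Evaluation of polynomials\<close>

definition monom_eval :: "('n::finite \<Rightarrow>\<^sub>0 nat) \<Rightarrow> real ^ 'n \<Rightarrow> real" where
  "monom_eval m x = (\<Prod>i\<in>UNIV. (x $ i) ^ Poly_Mapping.lookup m i)"

lemma monom_eval_zero [simp]: "monom_eval 0 x = 1"
  by (simp add: monom_eval_def)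

lemma monom_eval_add: "monom_eval (m + n) x = monom_eval m x * monom_eval n x"
  by (simp add: monom_eval_def lookup_add power_add prod.distrib)

lemma monom_eval_single [simp]: "monom_eval (Poly_Mapping.single i k) x = (x $ i) ^ k"
proof -
  have "monom_eval (Poly_Mapping.single i k) x = (\<Prod>j\<in>UNIV. if j = i then (x $ i) ^ k else 1)"
    unfolding monom_eval_def by (intro prod.cong) (auto simp: lookup_single when_def)
  then show ?thesis by simp
qed

text \<open>Monomials outside the support contribute 0, so several polynomials can be evaluated over
  one common index set.\<close>

lemma peval_superset:
  assumes "finite S" "Poly_Mapping.keys p \<subseteq> S"
  shows "peval p x = (\<Sum>m\<in>S. Poly_Mapping.lookup p m * monom_eval m x)"
  unfolding peval_def monom_eval_def using assms
  by (intro sum.mono_neutral_left) (auto simp: in_keys_iff)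

lemma peval_zero [simp]: "peval 0 x = 0"
  by (simp add: peval_def)

lemma peval_single [simp]: "peval (Poly_Mapping.single m c) x = c * monom_eval m x"
  by (subst peval_superset[of "{m}"]) auto

lemma peval_add [simp]: "peval (p + q) x = peval p x + peval q x"
  by (subst (1 2 3) peval_superset[of "Poly_Mapping.keys p \<union> Poly_Mapping.keys q"])
    (use keys_add[of p q] in \<open>auto simp: lookup_add algebra_simps sum.distrib\<close>)

lemma peval_uminus [simp]: "peval (- p) x = - peval p x"
  using peval_add[of p "- p" x] by simp

lemma peval_diff [simp]: "peval (p - q) x = peval p x - peval q x"
  using peval_add[of p "- q" x] by simp

lemma peval_sum [simp]: "peval (\<Sum>i\<in>A. f i) x = (\<Sum>i\<in>A. peval (f i) x)"
  by (induction A rule: infinite_finite_induct) auto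

lemma sum_single_keys: "(\<Sum>m\<in>Poly_Mapping.keys p. Poly_Mapping.single m (Poly_Mapping.lookup p m)) = p"
  by (rule poly_mapping_eqI) (auto simp: lookup_sum lookup_single when_def in_keys_iff)

lemma peval_mult [simp]: "peval (p * q) x = peval p x * peval q x"
proof -
  let ?s = "\<lambda>p m. Poly_Mapping.single m (Poly_Mapping.lookup p m)"
  have "p * q = (\<Sum>m\<in>Poly_Mapping.keys p. ?s p m) * (\<Sum>m\<in>Poly_Mapping.keys q. ?s q m)"
    by (simp add: sum_single_keys)
  also have "peval \<dots> x = peval (\<Sum>m\<in>Poly_Mapping.keys p. ?s p m) x * peval (\<Sum>m\<in>Poly_Mapping.keys q. ?s q m) x"
    by (simp add: sum_product mult_single monom_eval_add mult_ac)
  finally show ?thesis by (simp add: sum_single_keys)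
qed

lemma peval_one [simp]: "peval 1 x = 1"
  unfolding single_one[symmetric] by (subst peval_single) simp

lemma peval_power [simp]: "peval (p ^ n) x = peval p x ^ n"
  by (induction n) auto

lemma peval_numeral [simp]: "peval (numeral k) x = numeral k"
  unfolding single_numeral[symmetric] by (subst peval_single) simp

lemma peval_var_poly [simp]: "peval (var_poly i) x = x $ i"
  by (simp add: var_poly_def)

section \<open>Nonnegativity\<close>

text \<open>
  For every parameter \<open>A\<close> one has
  \<open>4 A p = 72 A (y^2 - g)^2 + (2 A y - c)^2 + t(x)\<close> with \<open>g = (A + 19)/36\<close>, \<open>c = 19 + 20 x\<close> and a
  univariate remainder \<open>t\<close>. The choices \<open>A = 10 + 10 x\<close> for \<open>x \<ge> - 4/5\<close> and \<open>A = 2\<close> for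
  \<open>x \<le> - 4/5\<close> make \<open>t\<close> nonnegative; the weighted sum of squares representations
  of \<open>t\<close> come from rounding a numerical solution of a semidefinite program.
\<close>

definition pfun :: "real \<Rightarrow> real \<Rightarrow> real" where
  "pfun x y = 17 * x^6 - 20 * x^4 + 7 * x^2 + 18 * x + 18 * y^4 - 19 * y^2 - 19 * y + 21 - 20 * x * y"

lemma pfun_nonneg_right:
  assumes "- (4/5) \<le> x"
  shows "0 \<le> pfun x y"
proof -
  have w: "0 \<le> x + 4/5" using assms by simp
  define A where "A = 10 + 10 * x"
  have A: "A > 0" using assms by (simp add: A_def)
  define t where "t = 680 * x^7 + 680 * x^6 - 800 * x^5 - 800 * x^4 + 2020/9 * x^3 + 2000/9 * x^2 + 95/9 * x + 106/9"
  have "t = (x + 4/5) * (680 * (1/85 - 421/680 * x - 9/680 * x^2 + x^3)^2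
          + 13519/680 * (- 7408/13519 + 291/13519 * x + x^2)^2
          + 18146/13519 * (1267/9073 + x)^2 + 8257/9073)
      + 154 * (- 202/3465 - 937/1540 * x + 13/110 * x^2 + x^3)^2
      + 8167/550 * (- 13741/24501 + 1181/16334 * x + x^2)^2
      + 437091/228676 * (629401/1311273 + x)^2 + 128273831/236029140"
    unfolding t_def by (simp add: algebra_simps eval_nat_numeral)
  also have "\<dots> \<ge> 0" by (rule w | rule add_nonneg_nonneg mult_nonneg_nonneg | simp)+
  finally have t: "t \<ge> 0" .
  have "4 * A * pfun x y = 72 * A * (y^2 - (A + 19) / 36)^2 + (2 * A * y - (19 + 20 * x))^2 + t"
    unfolding t_def A_def pfun_def by (simp add: algebra_simps add_divide_distrib diff_divide_distrib eval_nat_numeral)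
  also have "\<dots> \<ge> 0" using t A by (intro add_nonneg_nonneg mult_nonneg_nonneg) auto
  finally show ?thesis using A by (simp add: zero_le_mult_iff)
qed

lemma pfun_nonneg_left:
  assumes "x \<le> - (4/5)"
  shows "0 \<le> pfun x y"
proof -
  have w: "0 \<le> - (4/5) - x" using assms by simp
  define t where "t = 136 * x^6 - 160 * x^4 - 344 * x^2 - 616 * x - 242"
  have "t = (- (4/5) - x) * (1216 * (1361/1216 + 2621/1216 * x + x^2)^2
          + 1044087/1216 * (303377/348029 + x)^2 + 95448/348029)
      + 136 * (1349/680 + 1841/340 * x + 76/17 * x^2 + x^3)^2
      + 31686/17 * (37707/52810 + 44623/26405 * x + x^2)^2
      + 5154823/264050 * (8277327/10309646 + x)^2 + 38523707/51548230"
    unfolding t_def by (simp add: algebra_simps eval_nat_numeral)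
  also have "\<dots> \<ge> 0" using w by (intro add_nonneg_nonneg mult_nonneg_nonneg) auto
  finally have t: "t \<ge> 0" .
  have "8 * pfun x y = 144 * (y^2 - 7/12)^2 + (4 * y - (19 + 20 * x))^2 + t"
    unfolding t_def pfun_def by (simp add: algebra_simps add_divide_distrib diff_divide_distrib eval_nat_numeral)
  also have "\<dots> \<ge> 0" using t by (intro add_nonneg_nonneg) auto
  finally show ?thesis by simp
qed

lemma pfun_nonneg: "0 \<le> pfun x y"
  using pfun_nonneg_left pfun_nonneg_right by (cases "x \<le> - (4/5)") auto

section \<open>Degree bounds from growth\<close>

text \<open>If the degree \<open>d\<close> exceeded \<open>k\<close>, the square of
  \<open>poly f t / t ^ d\<close> would tend to the nonzero square of the leading coefficient, yet
  be at most \<open>C / t\<close>.\<close>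

lemma degree_le_of_square_bound:
  fixes f :: "real poly"
  assumes "\<And>t. t \<ge> 1 \<Longrightarrow> (poly f t)\<^sup>2 \<le> C * t ^ (2 * k)"
  shows "degree f \<le> k"
proof (rule ccontr)
  assume "\<not> degree f \<le> k"
  define d where "d = degree f"
  have d: "d > k" using \<open>\<not> degree f \<le> k\<close> by (simp add: d_def)
  then have "lead_coeff f \<noteq> 0" by (auto simp: d_def)
  have "((\<lambda>t. poly f t / t ^ d) \<longlongrightarrow> lead_coeff f) at_top"
    unfolding d_def by (rule tendsto_mono[OF at_top_le_at_infinity poly_divide_tendsto_aux])
  then have lim: "((\<lambda>t. (poly f t / t ^ d)\<^sup>2) \<longlongrightarrow> (lead_coeff f)\<^sup>2) at_top"
    by (rule tendsto_power)
  have "((\<lambda>t::real. C * inverse t) \<longlongrightarrow> C * 0) at_top"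
    by (intro tendsto_intros tendsto_inverse_0_at_top filterlim_ident)
  moreover have "\<forall>\<^sub>F t in at_top. (poly f t / t ^ d)\<^sup>2 \<le> C * inverse t"
    using eventually_ge_at_top[of 1]
  proof eventually_elim
    case (elim t)
    have "C \<ge> 0" using order_trans[OF zero_le_power2 assms[of 1]] by simp
    have "(poly f t / t ^ d)\<^sup>2 \<le> C * t ^ (2 * k) / t ^ (2 * d)"
      using assms[OF elim] elim by (simp add: power_divide power_mult[symmetric] mult.commute divide_right_mono)
    also have "\<dots> \<le> C * inverse t"
    proof -
      have "t ^ (2 * k) * t \<le> t ^ (2 * d)"
        using power_increasing[of "Suc (2 * k)" "2 * d" t] d elim by (simp add: mult.commute)
      then show ?thesis using elim \<open>C \<ge> 0\<close>
        by (simp add: field_simps mult_left_mono)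
    qed
    finally show ?case .
  qed
  ultimately have "(lead_coeff f)\<^sup>2 \<le> C * 0"
    using lim by (intro tendsto_le[of at_top]) auto
  with \<open>lead_coeff f \<noteq> 0\<close> show False by simp
qed

text \<open>Injectivity of \<open>w\<close> rules out cancellation: each \<open>c m\<close> survives
  as a coefficient of one univariate polynomial, whose degree is bounded.\<close>

lemma exponents_le_of_square_bound:
  fixes c :: "'a \<Rightarrow> real" and w :: "'a \<Rightarrow> nat"
  assumes "finite S" "inj_on w S" "\<And>m. m \<in> S \<Longrightarrow> c m \<noteq> 0"
    and bound: "\<And>t. t \<ge> 1 \<Longrightarrow> (\<Sum>m\<in>S. c m * t ^ w m)\<^sup>2 \<le> C * t ^ (2 * k)"
    and "m \<in> S"
  shows "w m \<le> k"
proof -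
  define f where "f = (\<Sum>m\<in>S. monom (c m) (w m))"
  have "poly f t = (\<Sum>m\<in>S. c m * t ^ w m)" for t
    by (simp add: f_def poly_sum poly_monom)
  with bound have deg: "degree f \<le> k" by (intro degree_le_of_square_bound) auto
  have "coeff f (w m) = (\<Sum>n\<in>S. if n = m then c n else 0)"
    unfolding f_def coeff_sum using assms(2,5) by (intro sum.cong) (auto simp: inj_on_def)
  then have "coeff f (w m) \<noteq> 0" using assms by simp
  then show ?thesis using deg le_degree le_trans by blast
qed

lemma monom_eval_vector:
  "monom_eval m (vector [a, b] :: real ^ 2) = a ^ Poly_Mapping.lookup m 1 * b ^ Poly_Mapping.lookup m 2"
  by (simp add: monom_eval_def UNIV_2)

lemma poly_mapping_2_eqI:
  fixes m n :: "2 \<Rightarrow>\<^sub>0 nat"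
  assumes "Poly_Mapping.lookup m 1 = Poly_Mapping.lookup n 1" "Poly_Mapping.lookup m 2 = Poly_Mapping.lookup n 2"
  shows "m = n"
proof (rule poly_mapping_eqI)
  fix i :: 2
  show "Poly_Mapping.lookup m i = Poly_Mapping.lookup n i"
    using exhaust_2[of i] assms by auto
qed

text \<open>The dominant term is \<open>18 * y^4\<close>, of exponent 4 (3 N + 1) = 2 (6 N + 2). The
  negative terms are dropped, and 81 is the sum of the positive coefficients.\<close>

lemma pfun_growth:
  assumes "N \<ge> 1" "t \<ge> 1"
  shows "pfun (t ^ (2 * N)) (t ^ (3 * N + 1)) \<le> 81 * t ^ (2 * (6 * N + 2))"
proof -
  have le: "t ^ k \<le> t ^ (2 * (6 * N + 2))" if "k \<le> 2 * (6 * N + 2)" for k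
    using assms that by (intro power_increasing) auto
  have pfun_le: "pfun x y \<le> 17 * x^6 + 7 * x^2 + 18 * x + 18 * y^4 + 21" if "0 \<le> x" "0 \<le> y" for x y
  proof -
    have "0 \<le> x^4" "0 \<le> y^2" "0 \<le> x * y" using that by simp_all
    then show ?thesis using that unfolding pfun_def by linarith
  qed
  have "pfun (t ^ (2 * N)) (t ^ (3 * N + 1)) \<le>
      17 * t ^ (2 * N * 6) + 7 * t ^ (2 * N * 2) + 18 * t ^ (2 * N) + 18 * t ^ ((3 * N + 1) * 4) + 21 * t ^ 0"
    using pfun_le[of "t ^ (2 * N)" "t ^ (3 * N + 1)"] assms unfolding power_mult[symmetric] by simp
  also have "\<dots> \<le> (17 + 7 + 18 + 18 + 21) * t ^ (2 * (6 * N + 2))"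
    unfolding distrib_right by (intro add_mono mult_left_mono le) auto
  finally show ?thesis by simp
qed

text \<open>
  This is the inclusion of the Newton polytope of \<open>q\<close> in half that of \<open>p\<close>. Perturbing the weights
  \<open>(2, 3)\<close> to \<open>(2 N, 3 N + 1)\<close> separates all monomials of \<open>q\<close>, so that no cancellation occurs
  along the curve \<open>t \<mapsto> (t^(2 N), t^(3 N + 1))\<close>.
\<close>

lemma weighted_degree_le:
  fixes q :: "2 rpoly"
  assumes bound: "\<And>x y. (peval q (vector [x, y]))\<^sup>2 \<le> pfun x y" and m: "m \<in> Poly_Mapping.keys q"
  shows "2 * Poly_Mapping.lookup m 1 + 3 * Poly_Mapping.lookup m 2 \<le> 6"
proof -
  let ?l = "Poly_Mapping.lookup"
  \<comment> \<open>\<open>N\<close> exceeds every y-exponent in \<open>q\<close>, so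
    \<open>w m mod N\<close> recovers that exponent. The summand 3 ensures 6 N + 2 < 7 N, which
    brings the weight below 7.\<close>
  define N where "N = 3 + (\<Sum>m\<in>Poly_Mapping.keys q. ?l m 2)"
  define w where "w = (\<lambda>m :: 2 \<Rightarrow>\<^sub>0 nat. 2 * N * ?l m 1 + (3 * N + 1) * ?l m 2)"
  have small: "?l m 2 < N" if "m \<in> Poly_Mapping.keys q" for m
    using member_le_sum[OF that, of "\<lambda>m. ?l m 2"] unfolding N_def by simp
  have w_alt: "w m = ?l m 2 + N * (2 * ?l m 1 + 3 * ?l m 2)" for m
    by (simp add: w_def algebra_simps)
  have inj: "inj_on w (Poly_Mapping.keys q)"
  proof (rule inj_onI)
    fix m n assume mn: "m \<in> Poly_Mapping.keys q" "n \<in> Poly_Mapping.keys q" "w m = w n"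
    have "w m mod N = ?l m 2" "w n mod N = ?l n 2"
      using small[OF mn(1)] small[OF mn(2)] by (simp_all add: w_alt)
    then have e2: "?l m 2 = ?l n 2" using mn(3) by simp
    then have "?l m 1 = ?l n 1" using mn(3) unfolding w_def N_def by simp
    with e2 show "m = n" by (intro poly_mapping_2_eqI)
  qed
  have "w m \<le> 6 * N + 2"
  proof (rule exponents_le_of_square_bound[OF _ inj _ _ m])
    fix t :: real assume "t \<ge> 1"
    have "t ^ w m = (t ^ (2 * N)) ^ ?l m 1 * (t ^ (3 * N + 1)) ^ ?l m 2" for m
      unfolding w_def by (subst power_add) (simp only: power_mult)
    then have "(\<Sum>m\<in>Poly_Mapping.keys q. ?l q m * t ^ w m) = peval q (vector [t ^ (2 * N), t ^ (3 * N + 1)])"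
      by (simp only: peval_superset[OF finite_keys order_refl] monom_eval_vector)
    also have "\<dots>\<^sup>2 \<le> pfun (t ^ (2 * N)) (t ^ (3 * N + 1))"
      by (rule bound)
    also have "\<dots> \<le> 81 * t ^ (2 * (6 * N + 2))"
      using \<open>t \<ge> 1\<close> by (intro pfun_growth) (simp_all add: N_def)
    finally show "(\<Sum>m\<in>Poly_Mapping.keys q. ?l q m * t ^ w m)\<^sup>2 \<le> 81 * t ^ (2 * (6 * N + 2))" .
  qed (auto simp: in_keys_iff)
  then have "N * (2 * ?l m 1 + 3 * ?l m 2) \<le> 6 * N + 2" by (simp add: w_alt)
  also have "\<dots> < N * 7" by (simp add: N_def)
  finally show ?thesis by simp
qed

section \<open>A linear relation between six point evaluations\<close>

text \<open>
  Two generic curves spanned by the seven monomials of weighted degree at most 6 meet in six points,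
  which impose only five conditions on the span (a Cayley--Bacharach phenomenon). The
  first five points approximate common zeros of two kernel elements of the moment matrix of an
  optimal dual functional, the sixth is then determined.
\<close>

lemma peval_relation:
  fixes q :: "2 rpoly"
  assumes "\<And>m. m \<in> Poly_Mapping.keys q \<Longrightarrow> 2 * Poly_Mapping.lookup m 1 + 3 * Poly_Mapping.lookup m 2 \<le> 6"
  shows "peval q (vector [1/10, - 5/3]) =
      395073/621673 * peval q (vector [- 9/10, - 1])
    + 6271/12206 * peval q (vector [4/5, - 2])
    - 43897/51656 * peval q (vector [- 4/5, 11/15])
    - 6271/13736 * peval q (vector [4/5, 1])
    + 9906470066304/8561693830547 * peval q (vector [- 1987/42840, 85340387/91763280])"
    (is "peval q ?P0 = ?b1 * peval q ?P1 + ?b2 * peval q ?P2 - ?b3 * peval q ?P3 - ?b4 * peval q ?P4 + ?b5 * peval q ?P5")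
proof -
  have mon: "monom_eval m ?P0 = ?b1 * monom_eval m ?P1 + ?b2 * monom_eval m ?P2
      - ?b3 * monom_eval m ?P3 - ?b4 * monom_eval m ?P4 + ?b5 * monom_eval m ?P5"
    if "m \<in> Poly_Mapping.keys q" for m
  proof -
    define i j where "i = Poly_Mapping.lookup m 1" and "j = Poly_Mapping.lookup m 2"
    have "2 * i + 3 * j \<le> 6" using assms[OF that] by (simp add: i_def j_def)
    \<comment> \<open>Only seven monomials remain; each is checked by rational arithmetic.\<close>
    then have "(i, j) \<in> {(0,0), (1,0), (2,0), (3,0), (0,1), (1,1), (0,2)}"
      by simp presburger
    then show ?thesis
      unfolding monom_eval_vector i_def[symmetric] j_def[symmetric]
      by (elim insertE emptyE) (simp_all add: power2_eq_square power3_eq_cube)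
  qed
  show ?thesis
    unfolding peval_superset[OF finite_keys order_refl]
    unfolding sum_distrib_left sum.distrib[symmetric] sum_subtractf[symmetric]
    by (intro sum.cong refl) (simp only: mon, simp add: algebra_simps)
qed

lemma L2_set_scale: "L2_set (\<lambda>j. c * f j) A = \<bar>c\<bar> * L2_set f A"
  by (simp add: L2_set_def power_mult_distrib sum_distrib_left[symmetric] real_sqrt_mult)

text \<open>Repeated application peels a right-nested linear combination one summand at a
  time.\<close>

lemma L2_set_scale_add_le:
  assumes "L2_set g A \<le> b"
  shows "L2_set (\<lambda>j. c * f j + g j) A \<le> \<bar>c\<bar> * L2_set f A + b"
  using L2_set_triangle_ineq[of "\<lambda>j. c * f j" g A] assms by (simp add: L2_set_scale)

lemma not_sum_of_squares:
  fixes q :: "nat \<Rightarrow> 2 rpoly"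
  assumes sos: "\<And>x y. pfun x y = (\<Sum>j<n. (peval (q j) (vector [x, y]))\<^sup>2)"
  shows False
proof -
  have "(peval (q j) (vector [x, y]))\<^sup>2 \<le> pfun x y" if "j < n" for j x y
    unfolding sos using that by (intro member_le_sum) auto
  then have deg: "2 * Poly_Mapping.lookup m 1 + 3 * Poly_Mapping.lookup m 2 \<le> 6"
    if "j < n" "m \<in> Poly_Mapping.keys (q j)" for j m
    using that weighted_degree_le by blast
  define V where "V = (\<lambda>x y j. peval (q j) (vector [x, y]))"
  define s where "s = (\<lambda>x y. L2_set (V x y) {..<n})"
  have s: "s x y = sqrt (pfun x y)" for x y
    by (simp add: s_def L2_set_def V_def sos)
  have "s (1/10) (- 5/3) = L2_set (\<lambda>j. 395073/621673 * V (- 9/10) (- 1) j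
    + (6271/12206 * V (4/5) (- 2) j
    + ((- 43897/51656) * V (- 4/5) (11/15) j
    + ((- 6271/13736) * V (4/5) 1 j
    + 9906470066304/8561693830547 * V (- 1987/42840) (85340387/91763280) j)))) {..<n}"
    unfolding s_def
  proof (rule L2_set_cong)
    fix j assume "j \<in> {..<n}"
    then show "V (1/10) (- 5/3) j = 395073/621673 * V (- 9/10) (- 1) j
    + (6271/12206 * V (4/5) (- 2) j
    + ((- 43897/51656) * V (- 4/5) (11/15) j
    + ((- 6271/13736) * V (4/5) 1 j
    + 9906470066304/8561693830547 * V (- 1987/42840) (85340387/91763280) j)))"
      unfolding V_def by (subst peval_relation[OF deg]) auto
  qed simp
  also have "\<dots> \<le> \<bar>395073/621673\<bar> * s (- 9/10) (- 1) + (\<bar>6271/12206\<bar> * s (4/5) (- 2)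
     + (\<bar>- 43897/51656\<bar> * s (- 4/5) (11/15) + (\<bar>- 6271/13736\<bar> * s (4/5) 1
     + \<bar>9906470066304/8561693830547\<bar> * s (- 1987/42840) (85340387/91763280))))"
    unfolding s_def by (intro L2_set_scale_add_le) (simp only: L2_set_scale order_refl)
  finally have main: "s (1/10) (- 5/3) \<le> \<dots>" .
  \<comment> \<open>With these roundings the right-hand side of \<open>main\<close> stays below
    11.991, while the left-hand side is at least 11.999.\<close>
  have "s (- 9/10) (- 1) \<le> 2.527"
    unfolding s by (rule real_le_lsqrt) (simp_all add: pfun_def power_divide eval_nat_numeral)
  moreover have "s (4/5) (- 2) \<le> 17.837"
    unfolding s by (rule real_le_lsqrt) (simp_all add: pfun_def power_divide eval_nat_numeral)
  moreover have "s (- 4/5) (11/15) \<le> 0.364"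
    unfolding s by (rule real_le_lsqrt) (simp_all add: pfun_def power_divide eval_nat_numeral)
  moreover have "s (4/5) 1 \<le> 0.381"
    unfolding s by (rule real_le_lsqrt) (simp_all add: pfun_def power_divide eval_nat_numeral)
  moreover have "s (- 1987/42840) (85340387/91763280) \<le> 0.637"
    unfolding s by (rule real_le_lsqrt) (simp_all add: pfun_def power_divide eval_nat_numeral)
  moreover have "11.999 \<le> s (1/10) (- 5/3)"
    unfolding s by (rule real_le_rsqrt) (simp add: pfun_def power_divide eval_nat_numeral)
  ultimately show False using main by simp
qed

section \<open>Separable plus quadratic form\<close>

lemma const_poly_zero [simp]: "const_poly 0 = 0"
  and const_poly_numeral [simp]: "const_poly (numeral k) = numeral k"
  and const_poly_uminus [simp]: "const_poly (- c) = - const_poly c"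
  by (auto simp: const_poly_def single_uminus)

text \<open>Horner's rule, by which an explicit coefficient list unfolds under simp.\<close>

lemma in_var_pCons: "in_var (pCons c f) i = const_poly c + var_poly i * in_var f i"
  by (simp add: in_var_def map_poly_pCons)

lemma in_var_zero [simp]: "in_var 0 i = 0"
  by (simp add: in_var_def)

lemma total_degree_le:
  assumes "\<And>m. m \<in> Poly_Mapping.keys p \<Longrightarrow> (\<Sum>i\<in>UNIV. Poly_Mapping.lookup m i) \<le> d"
  shows "total_degree p \<le> d"
  unfolding total_degree_def using assms by (subst Max_le_iff) auto

lemma vector_2_eta: "vector [x $ 1, x $ 2] = (x :: real ^ 2)"
  by (simp add: vec_eq_iff forall_2)

theorem theorem3p2:
  fixes x1 x2 p :: "2 rpoly"
  defines "x1 \<equiv> var_poly 1" and "x2 \<equiv> var_poly 2"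
  defines "p \<equiv> 17 * x1^6 - 20 * x1^4 + 7 * x1^2 + 18 * x1
              + 18 * x2^4 - 19 * x2^2 - 19 * x2 + 21 - 20 * x1 * x2"
  shows "SPQ p \<and> nonneg_poly p \<and> \<not> sos p"
proof (intro conjI)
  have peval_p: "peval p (vector [x, y]) = pfun x y" for x y
    by (simp add: p_def x1_def x2_def pfun_def)
  show "nonneg_poly p"
    unfolding nonneg_poly_def using pfun_nonneg peval_p by (metis vector_2_eta)
  show "\<not> sos p"
  proof
    assume "sos p"
    then obtain n and q :: "nat \<Rightarrow> 2 rpoly" where "p = (\<Sum>j<n. (q j)\<^sup>2)"
      unfolding sos_def by blast
    then have "pfun x y = (\<Sum>j<n. (peval (q j) (vector [x, y]))\<^sup>2)" for x y
      using peval_p[of x y] by simp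
    then show False by (rule not_sum_of_squares)
  qed
  \<comment> \<open>All terms except the constant and the mixed one go into the univariate
    parts.\<close>
  define f :: "2 \<Rightarrow> real poly" where
    "f = (\<lambda>i. if i = 1 then [:0, 18, 7, 0, - 20, 0, 17:] else [:0, - 19, - 19, 0, 18:])"
  define q :: "2 rpoly" where "q = 21 - 20 * x1 * x2"
  have "p = (\<Sum>i\<in>UNIV. in_var (f i) i) + q"
    unfolding p_def q_def f_def x1_def x2_def
    by (simp add: UNIV_2 in_var_pCons algebra_simps eval_nat_numeral)
  moreover have "total_degree q \<le> 2"
  proof (rule total_degree_le)
    let ?m = "Poly_Mapping.single 1 1 + Poly_Mapping.single 2 1 :: 2 \<Rightarrow>\<^sub>0 nat"
    have "q = Poly_Mapping.single 0 21 + Poly_Mapping.single ?m (- 20)"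
      unfolding q_def x1_def x2_def var_poly_def single_numeral[symmetric]
      by (simp add: mult_single single_uminus del: single_numeral)
    then have "Poly_Mapping.keys q \<subseteq> {0, ?m}"
      using keys_add[of "Poly_Mapping.single 0 21" "Poly_Mapping.single ?m (- 20 :: real)"]
      by (auto simp del: single_numeral split: if_splits)
    moreover fix m assume "m \<in> Poly_Mapping.keys q"
    ultimately show "(\<Sum>i\<in>UNIV. Poly_Mapping.lookup m i) \<le> 2"
      by (auto simp: UNIV_2 lookup_add lookup_single)
  qed
  ultimately show "SPQ p" unfolding SPQ_def by blast
qed

end
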